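(* Let $H$ be a separable complex Hilbert space. Let $B\in B(H)$ be a bounded normal operator with a finite pure point spectrum, and let $A$ be a closed (possibly unbounded) linear operator in $H$ with domain $D(A)\subset H$. Then $$BA\subset AB^*\ \Longrightarrow\ B^*A\subset AB.$$
   Context: $B(H)$ denotes the bounded everywhere-defined linear operators on $H$. For operators $S,T$ in $H$, $S\subset T$ means $D(S)\subset D(T)$ and $Sx=Tx$ for all $x\in D(S)$; products carry their natural domains, $D(ST)=\{x\in D(T): Tx\in D(S)\}$. "$B$ is normal with a finite pure point spectrum" means that $B$ has finitely many distinct eigenvalues $\lambda_1,\dots,\lambda_n$ whose orthogonal eigenprojectors $E_1,\dots,E_n$ add up to the identity, so that $B=\sum_{j=1}^n\lambda_jE_j$. *)

theory Defs
  imports "HOL-Analysis.Analysis"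
begin

text \<open>
  The real scalar multiplication, norm and topology are those of the superclass
  \<^class>\<open>real_normed_vector\<close>; the complex structure is added on top and tied to them by
  \<open>scaleR_scaleC\<close> and \<open>norm_eq_sqrt_cinner\<close>. Positive definiteness of the inner product is a
  consequence of the latter. The inner product is linear in its first argument.
\<close>

class complex_inner = real_normed_vector +
  fixes scaleC :: "complex \<Rightarrow> 'a \<Rightarrow> 'a" (infixr "*\<^sub>C" 75)
    and cinner :: "'a \<Rightarrow> 'a \<Rightarrow> complex"
  assumes scaleC_add_right: "a *\<^sub>C (x + y) = a *\<^sub>C x + a *\<^sub>C y"
    and scaleC_add_left: "(a + b) *\<^sub>C x = a *\<^sub>C x + b *\<^sub>C x"
    and scaleC_scaleC: "a *\<^sub>C b *\<^sub>C x = (a * b) *\<^sub>C x"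
    and scaleC_one: "1 *\<^sub>C x = x"
    and scaleR_scaleC: "r *\<^sub>R x = complex_of_real r *\<^sub>C x"
    and cinner_commute: "cinner x y = cnj (cinner y x)"
    and cinner_add_left: "cinner (x + y) z = cinner x z + cinner y z"
    and cinner_scaleC_left: "cinner (a *\<^sub>C x) y = a * cinner x y"
    and norm_eq_sqrt_cinner: "norm x = sqrt (Re (cinner x x))"

class chilbert_space = complex_inner + complete_space


definition bounded_clinear :: "('a::complex_inner \<Rightarrow> 'a) \<Rightarrow> bool" where
  "bounded_clinear B \<longleftrightarrow> bounded_linear B \<and> (\<forall>c x. B (c *\<^sub>C x) = c *\<^sub>C B x)"

definition cadjoint :: "('a::chilbert_space \<Rightarrow> 'a) \<Rightarrow> 'a \<Rightarrow> 'a" where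
  "cadjoint B = (THE B'. \<forall>x y. cinner (B x) y = cinner x (B' y))"

definition normal_op :: "('a::chilbert_space \<Rightarrow> 'a) \<Rightarrow> bool" where
  "normal_op B \<longleftrightarrow> B \<circ> cadjoint B = cadjoint B \<circ> B"

definition eigenspace :: "('a::complex_inner \<Rightarrow> 'a) \<Rightarrow> complex \<Rightarrow> 'a set" where
  "eigenspace B \<mu> = {x. B x = \<mu> *\<^sub>C x}"

definition eigenvalues :: "('a::complex_inner \<Rightarrow> 'a) \<Rightarrow> complex set" where
  "eigenvalues B = {\<mu>. \<exists>x. x \<noteq> 0 \<and> B x = \<mu> *\<^sub>C x}"

definition orthogonal_projector_onto :: "('a::complex_inner \<Rightarrow> 'a) \<Rightarrow> 'a set \<Rightarrow> bool" where
  "orthogonal_projector_onto P M \<longleftrightarrow>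
     (\<forall>x. P x \<in> M \<and> (\<forall>y\<in>M. cinner (x - P x) y = 0))"

definition finite_pure_point_spectrum :: "('a::complex_inner \<Rightarrow> 'a) \<Rightarrow> bool" where
  "finite_pure_point_spectrum B \<longleftrightarrow> finite (eigenvalues B) \<and>
     (\<exists>E. (\<forall>\<mu>\<in>eigenvalues B. orthogonal_projector_onto (E \<mu>) (eigenspace B \<mu>)) \<and>
          (\<forall>x. (\<Sum>\<mu>\<in>eigenvalues B. E \<mu> x) = x))"

text \<open>The decomposition \<open>B = (\<Sum>\<mu>. \<mu> E\<^sub>\<mu>)\<close> is implied by the definition above.\<close>

lemma finite_pure_point_spectrum_decomp:
  assumes "bounded_clinear B" and "finite_pure_point_spectrum B"
  obtains E where
    "\<And>\<mu>. \<mu> \<in> eigenvalues B \<Longrightarrow> orthogonal_projector_onto (E \<mu>) (eigenspace B \<mu>)"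
    "\<And>x. (\<Sum>\<mu>\<in>eigenvalues B. E \<mu> x) = x"
    "\<And>x. B x = (\<Sum>\<mu>\<in>eigenvalues B. \<mu> *\<^sub>C E \<mu> x)"
proof -
  obtain E where E: "\<forall>\<mu>\<in>eigenvalues B. orthogonal_projector_onto (E \<mu>) (eigenspace B \<mu>)"
    and I: "\<forall>x. (\<Sum>\<mu>\<in>eigenvalues B. E \<mu> x) = x"
    using assms(2) unfolding finite_pure_point_spectrum_def by blast
  interpret B: bounded_linear B
    using assms(1) by (simp add: bounded_clinear_def)
  have "B x = (\<Sum>\<mu>\<in>eigenvalues B. \<mu> *\<^sub>C E \<mu> x)" for x
  proof -
    have "B x = B (\<Sum>\<mu>\<in>eigenvalues B. E \<mu> x)"
      using I by simp
    also have "\<dots> = (\<Sum>\<mu>\<in>eigenvalues B. B (E \<mu> x))"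
      by (rule B.sum)
    also have "\<dots> = (\<Sum>\<mu>\<in>eigenvalues B. \<mu> *\<^sub>C E \<mu> x)"
      using E by (intro sum.cong) (auto simp: orthogonal_projector_onto_def eigenspace_def)
    finally show ?thesis .
  qed
  then show thesis
    using that E I by blast
qed


text \<open>
  An operator \<open>T\<close> in the space, with domain \<open>D(T) = dom T\<close>, is a partial map. Then \<open>\<circ>\<^sub>m\<close> is the
  product \<open>S T\<close> with its natural domain \<open>{x \<in> D(T). T x \<in> D(S)}\<close>, and \<open>\<subseteq>\<^sub>m\<close> is the extension
  relation \<open>S \<subset> T\<close>. No density of the domain is required.
\<close>

abbreviation everywhere_defined :: "('a \<Rightarrow> 'a) \<Rightarrow> ('a \<rightharpoonup> 'a)" where
  "everywhere_defined B \<equiv> \<lambda>x. Some (B x)"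

definition linear_operator :: "('a::complex_inner \<rightharpoonup> 'a) \<Rightarrow> bool" where
  "linear_operator A \<longleftrightarrow>
     0 \<in> dom A \<and>
     (\<forall>x\<in>dom A. \<forall>y\<in>dom A. x + y \<in> dom A \<and> the (A (x + y)) = the (A x) + the (A y)) \<and>
     (\<forall>c. \<forall>x\<in>dom A. c *\<^sub>C x \<in> dom A \<and> the (A (c *\<^sub>C x)) = c *\<^sub>C the (A x))"

definition closed_operator :: "('a::complex_inner \<rightharpoonup> 'a) \<Rightarrow> bool" where
  "closed_operator A \<longleftrightarrow> linear_operator A \<and> closed (Map.graph A)"

end

theory Submission
  imports Defs
begin

text \<open>
  Write \<open>x = (\<Sum>\<mu>. E\<^sub>\<mu> x)\<close> for \<open>x \<in> D(A)\<close>. Each \<open>E\<^sub>\<mu> x\<close> is zero or an eigenvector of \<open>B\<^sup>*\<close> for the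
  eigenvalue \<open>cnj \<mu>\<close>, and these eigenvalues are pairwise distinct. The hypothesis makes \<open>D(A)\<close> invariant under
  \<open>B\<^sup>*\<close>, and an invariant subspace that contains a finite sum of eigenvectors for distinct
  eigenvalues contains every summand (\<open>eigenvector_summands_in_invariant_subspace\<close>); so
  \<open>E\<^sub>\<mu> x \<in> D(A)\<close>.

  Put \<open>w = A E\<^sub>\<mu> x\<close>. The hypothesis gives \<open>B w = A B\<^sup>* E\<^sub>\<mu> x = cnj \<mu> w\<close>: the vector \<open>w\<close> is zero or an
  eigenvector of \<open>B\<close>. An operator that is diagonalised by orthogonal projectors has the same
  eigenvectors as its adjoint, with conjugate eigenvalues (\<open>cadjoint_eigenvector\<close>), whence
  \<open>B\<^sup>* w = \<mu> w = A B E\<^sub>\<mu> x\<close>. Summing over the finitely many \<open>\<mu>\<close> gives \<open>B x \<in> D(A)\<close> and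
  \<open>B\<^sup>* A x = A B x\<close>.
\<close>


section \<open>Sums of eigenvectors\<close>

interpretation cvec: vector_space "scaleC :: complex \<Rightarrow> 'a \<Rightarrow> 'a::complex_inner"
  by unfold_locales
    (simp_all add: scaleC_add_right scaleC_add_left scaleC_scaleC scaleC_one)

abbreviation clin :: "('a::complex_inner \<Rightarrow> 'a) \<Rightarrow> bool" where
  "clin \<equiv> Vector_Spaces.linear scaleC scaleC"

lemma clinI:
  fixes T :: "'a::complex_inner \<Rightarrow> 'a"
  assumes "\<And>x y. T (x + y) = T x + T y" and "\<And>c x. T (c *\<^sub>C x) = c *\<^sub>C T x"
  shows "clin T"
  using assms by unfold_locales auto

lemma clin_sum: "clin T \<Longrightarrow> T (\<Sum>i\<in>S. v i) = (\<Sum>i\<in>S. T (v i))"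
  using Vector_Spaces.linear.axioms(3) module_hom.sum by blast

lemma clin_scale: "clin T \<Longrightarrow> T (c *\<^sub>C x) = c *\<^sub>C T x"
  using Vector_Spaces.linear.axioms(3) module_hom.scale by blast

lemma bounded_clinear_clin: "bounded_clinear B \<Longrightarrow> clin B"
  by (rule clinI) (simp_all add: bounded_clinear_def linear_simps)

text \<open>
  Applying \<open>T - f \<nu>\<close> to the sum kills the summand for \<open>\<nu>\<close> and rescales the other ones by the
  nonzero numbers \<open>f \<mu> - f \<nu>\<close>, which allows induction on the number of summands. For the
  subspace \<open>{0}\<close> this is the linear independence of eigenvectors.
\<close>

lemma eigenvector_summands_in_invariant_subspace:
  fixes T :: "'a::complex_inner \<Rightarrow> 'a" and f :: "'i \<Rightarrow> complex"
  assumes "finite S" and "clin T"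
    and D: "cvec.subspace D" and inv: "\<And>x. x \<in> D \<Longrightarrow> T x \<in> D"
    and "inj_on f S" and "\<And>\<mu>. \<mu> \<in> S \<Longrightarrow> T (v \<mu>) = f \<mu> *\<^sub>C v \<mu>"
    and "(\<Sum>\<mu>\<in>S. v \<mu>) \<in> D"
  shows "\<forall>\<mu>\<in>S. v \<mu> \<in> D"
  using assms(1,5-)
proof (induction S arbitrary: v rule: finite_induct)
  case empty
  then show ?case by simp
next
  case (insert \<nu> S)
  let ?s = "\<Sum>\<mu>\<in>insert \<nu> S. v \<mu>"
  let ?w = "\<lambda>\<mu>. (f \<mu> - f \<nu>) *\<^sub>C v \<mu>"
  have "T ?s - f \<nu> *\<^sub>C ?s = (\<Sum>\<mu>\<in>insert \<nu> S. f \<mu> *\<^sub>C v \<mu>) - (\<Sum>\<mu>\<in>insert \<nu> S. f \<nu> *\<^sub>C v \<mu>)"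
    unfolding clin_sum[OF \<open>clin T\<close>] cvec.scale_sum_right
    using insert.prems(2) by (intro arg_cong2[where f = minus] sum.cong) auto
  also have "\<dots> = (\<Sum>\<mu>\<in>S. ?w \<mu>)"
    using insert.hyps by (simp add: sum_subtractf[symmetric] cvec.scale_left_diff_distrib)
  finally have "(\<Sum>\<mu>\<in>S. ?w \<mu>) \<in> D"
    using cvec.subspace_diff[OF D inv cvec.subspace_scale[OF D]] insert.prems(3) by metis
  moreover have "T (?w \<mu>) = f \<mu> *\<^sub>C ?w \<mu>" if "\<mu> \<in> S" for \<mu>
    using insert.prems(2)[of \<mu>] that
    by (simp add: clin_scale[OF \<open>clin T\<close>] scaleC_scaleC mult.commute)
  moreover have "inj_on f S"
    using insert.prems(1) by simp
  ultimately have w: "\<forall>\<mu>\<in>S. ?w \<mu> \<in> D"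
    using insert.IH[of ?w] by simp
  have vS: "v \<mu> \<in> D" if "\<mu> \<in> S" for \<mu>
  proof -
    have "f \<mu> \<noteq> f \<nu>"
      using insert.prems(1) insert.hyps that by (auto simp: inj_on_def)
    then have "inverse (f \<mu> - f \<nu>) *\<^sub>C ?w \<mu> = v \<mu>"
      by (simp add: scaleC_scaleC scaleC_one)
    then show ?thesis
      using cvec.subspace_scale[OF D, of "?w \<mu>" "inverse (f \<mu> - f \<nu>)"] w that by simp
  qed
  have "v \<nu> = ?s - (\<Sum>\<mu>\<in>S. v \<mu>)"
    using insert.hyps by simp
  also have "\<dots> \<in> D"
    using cvec.subspace_diff[OF D insert.prems(3)] cvec.subspace_sum[OF D] vS by blast
  finally show ?case
    using vS by blast
qed


section \<open>The adjoint of a diagonal operator\<close>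

lemma cinner_add_right: "cinner x (y + z) = cinner x y + cinner x (z::'a::complex_inner)"
  unfolding cinner_commute[of x "y + z"] cinner_commute[of x y] cinner_commute[of x z]
  by (simp add: cinner_add_left)

lemma cinner_scaleC_right: "cinner x (c *\<^sub>C y) = cnj c * cinner x (y::'a::complex_inner)"
  unfolding cinner_commute[of x "c *\<^sub>C y"] cinner_commute[of x y] by (simp add: cinner_scaleC_left)

lemma cinner_zero_left: "cinner 0 (y::'a::complex_inner) = 0"
  using cinner_add_left[of 0 0 y] by simp

lemma cinner_zero_right: "cinner (y::'a::complex_inner) 0 = 0"
  using cinner_add_right[of y 0 0] by simp

lemma cinner_diff_left: "cinner (x - y) z = cinner x z - cinner y (z::'a::complex_inner)"
  using cinner_add_left[of "x - y" y z] by simp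

lemma cinner_diff_right: "cinner x (y - z) = cinner x y - cinner x (z::'a::complex_inner)"
  using cinner_add_right[of x "y - z" z] by simp

lemma cinner_sum_left: "cinner (\<Sum>i\<in>S. v i) y = (\<Sum>i\<in>S. cinner (v i) (y::'a::complex_inner))"
  by (induction S rule: infinite_finite_induct) (simp_all add: cinner_zero_left cinner_add_left)

lemma cinner_sum_right: "cinner y (\<Sum>i\<in>S. v i) = (\<Sum>i\<in>S. cinner y (v i::'a::complex_inner))"
  by (induction S rule: infinite_finite_induct) (simp_all add: cinner_zero_right cinner_add_right)

lemma cinner_right_eqI:
  fixes y z :: "'a::complex_inner"
  assumes "\<And>x. cinner x y = cinner x z"
  shows "y = z"
proof -
  have "cinner (y - z) (y - z) = 0"
    using assms by (simp add: cinner_diff_right)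
  then have "norm (y - z) = 0"
    by (simp add: norm_eq_sqrt_cinner)
  then show ?thesis
    by simp
qed

lemma cadjoint_eqI:
  assumes "\<And>x y. cinner (B x) y = cinner x (B' y)"
  shows "cadjoint B = B'"
  unfolding cadjoint_def
proof (rule the_equality)
  fix C assume "\<forall>x y. cinner (B x) y = cinner x (C y)"
  then show "C = B'"
    using assms by (metis cinner_right_eqI ext)
qed (use assms in blast)

text \<open>Orthogonality of \<open>u - P u\<close> to the range of \<open>P\<close> makes both sides equal to \<open>\<langle>P x, P y\<rangle>\<close>.\<close>

lemma orthogonal_projector_self_adjoint:
  assumes "orthogonal_projector_onto P M"
  shows "cinner (P x) y = cinner x (P y)"
proof -
  have P: "cinner u (P v) = cinner (P u) (P v)" for u v
  proof -
    have "cinner (u - P u) (P v) = 0"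
      using assms unfolding orthogonal_projector_onto_def by blast
    then show ?thesis
      by (simp add: cinner_diff_left)
  qed
  have "cinner (P x) y = cnj (cinner (P y) (P x))"
    using cinner_commute[of "P x" y] P[of y x] by simp
  also have "\<dots> = cinner x (P y)"
    using cinner_commute[of "P x" "P y"] P[of x y] by simp
  finally show ?thesis .
qed

text \<open>
  As the projectors are self-adjoint, the combination with conjugate coefficients satisfies the
  identity that defines the adjoint. This shows at once that the adjoint exists and what it is.
\<close>

lemma cadjoint_diagonal:
  fixes B :: "'a::chilbert_space \<Rightarrow> 'a"
  assumes "\<And>\<mu>. \<mu> \<in> S \<Longrightarrow> orthogonal_projector_onto (E \<mu>) (M \<mu>)"
    and B: "\<And>x. B x = (\<Sum>\<mu>\<in>S. \<mu> *\<^sub>C E \<mu> x)"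
  shows "cadjoint B = (\<lambda>x. \<Sum>\<mu>\<in>S. cnj \<mu> *\<^sub>C E \<mu> x)"
    and "cinner (B x) y = cinner x (cadjoint B y)"
proof -
  have *: "cinner (B x) y = cinner x (\<Sum>\<mu>\<in>S. cnj \<mu> *\<^sub>C E \<mu> y)" for x y
    by (simp add: B cinner_sum_left cinner_sum_right cinner_scaleC_left cinner_scaleC_right
        orthogonal_projector_self_adjoint[OF assms(1)] cong: sum.cong)
  show 1: "cadjoint B = (\<lambda>x. \<Sum>\<mu>\<in>S. cnj \<mu> *\<^sub>C E \<mu> x)"
    by (rule cadjoint_eqI) (rule *)
  show "cinner (B x) y = cinner x (cadjoint B y)"
    unfolding 1 by (rule *)
qed

lemma cadjoint_clin:
  assumes "\<And>x y. cinner (B x) y = cinner x (cadjoint B y)"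
  shows "clin (cadjoint B)"
  by (rule clinI; rule cinner_right_eqI)
    (simp_all add: assms[symmetric] cinner_add_right cinner_scaleC_right)

text \<open>
  Comparing \<open>B v = (\<Sum>\<mu>. \<mu> E\<^sub>\<mu> v)\<close> with \<open>\<nu> v = (\<Sum>\<mu>. \<nu> E\<^sub>\<mu> v)\<close>, independence of eigenvectors gives
  \<open>E\<^sub>\<mu> v = 0\<close> for all \<open>\<mu> \<noteq> \<nu>\<close>. Hence \<open>B\<^sup>* v = (\<Sum>\<mu>. cnj \<mu> E\<^sub>\<mu> v)\<close> reduces to
  \<open>cnj \<nu> v\<close>. The case \<open>v = 0\<close> is included because the lemma is applied to images under \<open>A\<close>,
  which may vanish.
\<close>

lemma cadjoint_eigenvector:
  fixes B :: "'a::chilbert_space \<Rightarrow> 'a"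
  assumes "finite S" and "clin B"
    and E: "\<And>\<mu>. \<mu> \<in> S \<Longrightarrow> orthogonal_projector_onto (E \<mu>) (eigenspace B \<mu>)"
    and I: "\<And>x. (\<Sum>\<mu>\<in>S. E \<mu> x) = x"
    and B: "\<And>x. B x = (\<Sum>\<mu>\<in>S. \<mu> *\<^sub>C E \<mu> x)"
    and v: "B v = \<nu> *\<^sub>C v"
  shows "cadjoint B v = cnj \<nu> *\<^sub>C v"
proof -
  have BE: "B (E \<mu> v) = \<mu> *\<^sub>C E \<mu> v" if "\<mu> \<in> S" for \<mu>
    using E[OF that] by (auto simp: orthogonal_projector_onto_def eigenspace_def)
  have "(\<Sum>\<mu>\<in>S. (\<mu> - \<nu>) *\<^sub>C E \<mu> v) = B v - \<nu> *\<^sub>C v"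
    using I[of v]
    by (simp add: B cvec.scale_left_diff_distrib sum_subtractf flip: cvec.scale_sum_right)
  also have "\<dots> \<in> {0}"
    by (simp add: v)
  finally have 0: "(\<Sum>\<mu>\<in>S. (\<mu> - \<nu>) *\<^sub>C E \<mu> v) \<in> {0}" .
  have "\<forall>\<mu>\<in>S. (\<mu> - \<nu>) *\<^sub>C E \<mu> v \<in> {0}"
  proof (rule eigenvector_summands_in_invariant_subspace[where f = id and T = B])
    show "B ((\<mu> - \<nu>) *\<^sub>C E \<mu> v) = id \<mu> *\<^sub>C (\<mu> - \<nu>) *\<^sub>C E \<mu> v" if "\<mu> \<in> S" for \<mu>
      using BE[OF that] by (simp add: clin_scale[OF \<open>clin B\<close>] scaleC_scaleC mult.commute)
    show "B x \<in> {0}" if "x \<in> {0}" for x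
      using that clin_scale[OF \<open>clin B\<close>, of 0 0] by simp
  qed (use assms(1,2) 0 in \<open>simp_all add: cvec.subspace_0\<close>)
  then have "cnj \<mu> *\<^sub>C E \<mu> v = cnj \<nu> *\<^sub>C E \<mu> v" if "\<mu> \<in> S" for \<mu>
    using that by fastforce
  then have "(\<Sum>\<mu>\<in>S. cnj \<mu> *\<^sub>C E \<mu> v) = (\<Sum>\<mu>\<in>S. cnj \<nu> *\<^sub>C E \<mu> v)"
    by (rule sum.cong[OF refl])
  then have "cadjoint B v = (\<Sum>\<mu>\<in>S. cnj \<nu> *\<^sub>C E \<mu> v)"
    using fun_cong[OF cadjoint_diagonal(1)[OF E B], of v] by simp
  also have "\<dots> = cnj \<nu> *\<^sub>C v"
    by (simp add: I flip: cvec.scale_sum_right)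
  finally show ?thesis .
qed


section \<open>Intertwining by an unbounded operator\<close>

lemma linear_operator_subspace: "linear_operator A \<Longrightarrow> cvec.subspace (dom A)"
  unfolding linear_operator_def cvec.subspace_def by blast

lemma linear_operator_sum:
  assumes "linear_operator A" and "\<And>i. i \<in> S \<Longrightarrow> v i \<in> dom A"
  shows "the (A (\<Sum>i\<in>S. v i)) = (\<Sum>i\<in>S. the (A (v i)))"
proof -
  have zero: "the (A 0) = 0"
    using assms(1) cvec.scale_zero_left unfolding linear_operator_def by metis
  show ?thesis
    using assms(2)
  proof (induction S rule: infinite_finite_induct)
    case (insert i S)
    have "(\<Sum>i\<in>S. v i) \<in> dom A"
      using insert.prems by (intro cvec.subspace_sum linear_operator_subspace assms(1)) auto
    then show ?case
      using insert assms(1) by (simp add: linear_operator_def)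
  qed (simp_all add: zero)
qed

text \<open>The product \<open>S A\<close> has domain \<open>D(A)\<close>, as \<open>S\<close> imposes no restriction on the values of \<open>A\<close>.\<close>

lemma everywhere_defined_comp_le_iff:
  "everywhere_defined S \<circ>\<^sub>m A \<subseteq>\<^sub>m A \<circ>\<^sub>m everywhere_defined T \<longleftrightarrow>
    (\<forall>x\<in>dom A. T x \<in> dom A \<and> the (A (T x)) = S (the (A x)))"
proof -
  have "dom (everywhere_defined S \<circ>\<^sub>m A) = dom A"
    by (auto simp: map_comp_def split: option.splits)
  then have "everywhere_defined S \<circ>\<^sub>m A \<subseteq>\<^sub>m A \<circ>\<^sub>m everywhere_defined T \<longleftrightarrow>
      (\<forall>x\<in>dom A. Some (S (the (A x))) = A (T x))"
    unfolding map_le_def by (intro ball_cong) (auto simp: map_comp_def)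
  also have "\<dots> \<longleftrightarrow> (\<forall>x\<in>dom A. T x \<in> dom A \<and> the (A (T x)) = S (the (A x)))"
    by (metis domI domIff option.sel option.collapse)
  finally show ?thesis .
qed

theorem corollary2p2:
  fixes B :: "'a::chilbert_space \<Rightarrow> 'a" and A :: "'a \<rightharpoonup> 'a"
  assumes "separable_space (euclidean :: 'a topology)"
    and "bounded_clinear B" and "normal_op B" and "finite_pure_point_spectrum B"
    and "closed_operator A"
    and "everywhere_defined B \<circ>\<^sub>m A \<subseteq>\<^sub>m A \<circ>\<^sub>m everywhere_defined (cadjoint B)"
  shows "everywhere_defined (cadjoint B) \<circ>\<^sub>m A \<subseteq>\<^sub>m A \<circ>\<^sub>m everywhere_defined B"
proof -
  let ?S = "eigenvalues B" and ?A = "\<lambda>x. the (A x)"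
  obtain E where E: "\<And>\<mu>. \<mu> \<in> ?S \<Longrightarrow> orthogonal_projector_onto (E \<mu>) (eigenspace B \<mu>)"
    and I: "\<And>x. (\<Sum>\<mu>\<in>?S. E \<mu> x) = x"
    and B: "\<And>x. B x = (\<Sum>\<mu>\<in>?S. \<mu> *\<^sub>C E \<mu> x)"
    using finite_pure_point_spectrum_decomp[OF assms(2,4)] by blast
  have fin: "finite ?S"
    using assms(4) by (simp add: finite_pure_point_spectrum_def)
  have linB: "clin B"
    using assms(2) by (rule bounded_clinear_clin)
  have linB': "clin (cadjoint B)"
    using cadjoint_diagonal(2)[OF E B] by (rule cadjoint_clin)
  have eigen: "cadjoint B v = cnj \<nu> *\<^sub>C v" if "B v = \<nu> *\<^sub>C v" for v \<nu>
    using cadjoint_eigenvector[OF fin linB E I B that] .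
  have linA: "linear_operator A"
    using assms(5) by (simp add: closed_operator_def)
  note D = linear_operator_subspace[OF linA]
  have scaleA: "?A (c *\<^sub>C x) = c *\<^sub>C ?A x" if "x \<in> dom A" for c x
    using linA that by (simp add: linear_operator_def)
  have hyp: "cadjoint B x \<in> dom A" "?A (cadjoint B x) = B (?A x)" if "x \<in> dom A" for x
    using assms(6) that unfolding everywhere_defined_comp_le_iff by blast+
  have "B x \<in> dom A \<and> ?A (B x) = cadjoint B (?A x)" if x: "x \<in> dom A" for x
  proof -
    have B'E: "cadjoint B (E \<mu> x) = cnj \<mu> *\<^sub>C E \<mu> x" if "\<mu> \<in> ?S" for \<mu>
      using E[OF that] by (intro eigen) (auto simp: orthogonal_projector_onto_def eigenspace_def)
    have "\<forall>\<mu>\<in>?S. E \<mu> x \<in> dom A"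
      using x by (intro eigenvector_summands_in_invariant_subspace[where f = cnj, OF fin linB' D])
        (simp_all add: hyp B'E I inj_on_def)
    then have ED: "E \<mu> x \<in> dom A" if "\<mu> \<in> ?S" for \<mu>
      using that by blast
    have AE: "?A (\<mu> *\<^sub>C E \<mu> x) = cadjoint B (?A (E \<mu> x))" if "\<mu> \<in> ?S" for \<mu>
    proof -
      have "B (?A (E \<mu> x)) = cnj \<mu> *\<^sub>C ?A (E \<mu> x)"
        using hyp(2)[OF ED[OF that]] B'E[OF that] scaleA[OF ED[OF that]] by simp
      from eigen[OF this] show ?thesis
        using scaleA[OF ED[OF that]] by simp
    qed
    have BED: "\<mu> *\<^sub>C E \<mu> x \<in> dom A" if "\<mu> \<in> ?S" for \<mu>
      using cvec.subspace_scale[OF D] ED that by blast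
    have "?A (B x) = (\<Sum>\<mu>\<in>?S. cadjoint B (?A (E \<mu> x)))"
      using linear_operator_sum[OF linA BED, of ?S "\<lambda>\<mu>. \<mu>"] AE by (simp add: B cong: sum.cong)
    also have "\<dots> = cadjoint B (?A (\<Sum>\<mu>\<in>?S. E \<mu> x))"
      by (simp add: clin_sum[OF linB'] linear_operator_sum[OF linA ED])
    finally have "?A (B x) = cadjoint B (?A x)"
      by (simp add: I)
    moreover have "B x \<in> dom A"
      using cvec.subspace_sum[OF D BED, of ?S "\<lambda>\<mu>. \<mu>"] by (simp add: B)
    ultimately show ?thesis
      by blast
  qed
  then show ?thesis
    unfolding everywhere_defined_comp_le_iff by blast
qed

end
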